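(* Let $n$ be even. The function $\mathrm{EQUAL}:\{0,1\}^n\to\{0,1\}$ can be computed by a D&C SPN of size $O(n)$ and depth 4.
   Context: $\mathrm{EQUAL}(x)=1$ if $(x_1,\dots,x_{n/2})=(x_{n/2+1},\dots,x_n)$ and $0$ otherwise. Arithmetic circuits: an arithmetic circuit $\Phi$ over a tuple of variables $y$ is a finite directed acyclic graph with a unique node of out-degree $0$ (the root). Each node of in-degree $0$ is labeled by a variable of $y$ or a real constant; every other node is labeled $\times$ (product node) or $+$ (sum node), and edges into sum nodes carry real weights. The children $C(u)$ of $u$ are the nodes with an edge into $u$. Labeled leaves compute their labels, a product node computes $q_u=\prod_{v\in C(u)}q_v$, a sum node computes $q_u=\sum_{v\in C(u)}w_{v,u}q_v$; $q_\Phi$ is the polynomial computed by the root. $\Phi$ is monotone if all weights and constants are non-negative. The size is the number of nodes. SPNs: let $x_i\in\{0,1\}$ (with counting measure) and let $f$ be a tuple of non-negative univariate functions $f_{i,j}(x_i)$ (the choice of $f$ is part of the SPN). A Sum Product Network (SPN) is a monotone arithmetic circuit over $f$; it computes the function $x\mapsto q_\Phi(f(x))$. The dependency-scope of a node $u$ is the set of those $x_i$ such that some $f_{i,j}$ labels a node in the sub-circuit rooted at $u$. An SPN is decomposable if for every product node the dependency-scopes of its children are pairwise disjoint, complete if for every sum node the dependency-scopes of its children are all equal, and a D&C SPN if it is both. Depth convention: depth is the number of layers, where the layer of input (leaf) nodes counts as the first layer and the children of nodes of each later layer lie in the previous layer. *)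

theory Defs
  imports Complex_Main "HOL-Library.FuncSet" "HOL-Library.Disjoint_Sets"
    "HOL-Library.Landau_Symbols"
begin

datatype 'v gate = VarLeaf 'v | ConstLeaf real | ProdGate | SumGate

text \<open>
  An edge \<open>(v, u)\<close> points from the child \<open>v\<close> to its parent \<open>u\<close>. The value
  \<open>weight \<Phi> v u\<close> is meaningful only if \<open>(v, u)\<close> is an edge into a sum node.
\<close>

record ('a, 'v) circuit =
  nodes :: "'a set"
  edges :: "('a \<times> 'a) set"
  label :: "'a \<Rightarrow> 'v gate"
  weight :: "'a \<Rightarrow> 'a \<Rightarrow> real"

definition children :: "('a, 'v) circuit \<Rightarrow> 'a \<Rightarrow> 'a set" where
  "children \<Phi> u = {v. (v, u) \<in> edges \<Phi>}"

definition is_root :: "('a, 'v) circuit \<Rightarrow> 'a \<Rightarrow> bool" where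
  "is_root \<Phi> r \<longleftrightarrow> r \<in> nodes \<Phi> \<and> (\<forall>u. (r, u) \<notin> edges \<Phi>)"

locale arithmetic_circuit =
  fixes Y :: "'v set" and \<Phi> :: "('a, 'v) circuit"
  assumes finite_nodes: "finite (nodes \<Phi>)"
    and edges_nodes: "edges \<Phi> \<subseteq> nodes \<Phi> \<times> nodes \<Phi>"
    and acyclic_edges: "acyclic (edges \<Phi>)"
    and unique_root: "\<exists>!r. is_root \<Phi> r"
    and leaf_iff: "\<And>u. u \<in> nodes \<Phi> \<Longrightarrow>
          children \<Phi> u = {} \<longleftrightarrow> (\<exists>y. label \<Phi> u = VarLeaf y) \<or> (\<exists>c. label \<Phi> u = ConstLeaf c)"
    and leaf_vars: "\<And>u y. u \<in> nodes \<Phi> \<Longrightarrow> label \<Phi> u = VarLeaf y \<Longrightarrow> y \<in> Y"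

definition root :: "('a, 'v) circuit \<Rightarrow> 'a" where
  "root \<Phi> = (THE r. is_root \<Phi> r)"

text \<open>
  The polynomial \<open>q\<^sub>u\<close> computed at a node \<open>u\<close>, given as a polynomial function of the
  values \<open>y\<close> of the variables. The recursion follows the edges, which form a
  well-founded relation in an arithmetic circuit; see \<open>node_poly_unfold\<close> below.
\<close>

definition node_poly :: "('a, 'v) circuit \<Rightarrow> ('v \<Rightarrow> real) \<Rightarrow> 'a \<Rightarrow> real" where
  "node_poly \<Phi> y = wfrec (edges \<Phi>) (\<lambda>q u.
     case label \<Phi> u of
       VarLeaf z \<Rightarrow> y z
     | ConstLeaf c \<Rightarrow> c
     | ProdGate \<Rightarrow> (\<Prod>v\<in>children \<Phi> u. q v)
     | SumGate \<Rightarrow> (\<Sum>v\<in>children \<Phi> u. weight \<Phi> v u * q v))"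

lemma (in arithmetic_circuit) wf_edges: "wf (edges \<Phi>)"
  using finite_nodes edges_nodes acyclic_edges
  by (meson finite_SigmaI finite_acyclic_wf finite_subset)

lemma (in arithmetic_circuit) node_poly_unfold:
  "node_poly \<Phi> y u =
     (case label \<Phi> u of
       VarLeaf z \<Rightarrow> y z
     | ConstLeaf c \<Rightarrow> c
     | ProdGate \<Rightarrow> (\<Prod>v\<in>children \<Phi> u. node_poly \<Phi> y v)
     | SumGate \<Rightarrow> (\<Sum>v\<in>children \<Phi> u. weight \<Phi> v u * node_poly \<Phi> y v))"
  unfolding node_poly_def
  by (subst wfrec[OF wf_edges])
     (auto simp: cut_apply children_def split: gate.split intro!: prod.cong sum.cong)

definition circuit_poly :: "('a, 'v) circuit \<Rightarrow> ('v \<Rightarrow> real) \<Rightarrow> real" where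
  "circuit_poly \<Phi> y = node_poly \<Phi> y (root \<Phi>)"

definition monotone_circuit :: "('a, 'v) circuit \<Rightarrow> bool" where
  "monotone_circuit \<Phi> \<longleftrightarrow>
     (\<forall>u\<in>nodes \<Phi>. \<forall>c. label \<Phi> u = ConstLeaf c \<longrightarrow> c \<ge> 0) \<and>
     (\<forall>u\<in>nodes \<Phi>. label \<Phi> u = SumGate \<longrightarrow> (\<forall>v\<in>children \<Phi> u. weight \<Phi> v u \<ge> 0))"

definition circuit_size :: "('a, 'v) circuit \<Rightarrow> nat" where
  "circuit_size \<Phi> = card (nodes \<Phi>)"

text \<open>
  The nodes are arranged in exactly \<open>d\<close> nonempty layers: the first one consists of the
  leaves, and the children of a node of a later layer lie in the layer just before it.
  In an arithmetic circuit this determines \<open>d\<close>, which is the layer of the root.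
\<close>

definition has_depth :: "('a, 'v) circuit \<Rightarrow> nat \<Rightarrow> bool" where
  "has_depth \<Phi> d \<longleftrightarrow> (\<exists>layer :: 'a \<Rightarrow> nat.
     layer ` nodes \<Phi> = {1..d} \<and>
     (\<forall>u\<in>nodes \<Phi>. layer u = 1 \<longleftrightarrow> children \<Phi> u = {}) \<and>
     (\<forall>(v, u)\<in>edges \<Phi>. layer u = layer v + 1))"

text \<open>
  The variable \<open>(i, j)\<close> of a circuit stands for the univariate function \<open>f i j\<close> of \<open>x i\<close>.
  The set \<open>J\<close> is the finite index set of the tuple \<open>f\<close>, so that values of \<open>f\<close> outside
  of \<open>J\<close> are irrelevant.
\<close>

definition is_spn ::
  "nat \<Rightarrow> (nat \<times> nat) set \<Rightarrow> (nat \<Rightarrow> nat \<Rightarrow> nat \<Rightarrow> real) \<Rightarrow> ('a, nat \<times> nat) circuit \<Rightarrow> bool" where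
  "is_spn n J f \<Phi> \<longleftrightarrow>
     finite J \<and> J \<subseteq> {1..n} \<times> UNIV \<and>
     (\<forall>(i, j)\<in>J. \<forall>b\<in>{0, 1}. f i j b \<ge> 0) \<and>
     arithmetic_circuit J \<Phi> \<and> monotone_circuit \<Phi>"

definition spn_fun ::
  "(nat \<Rightarrow> nat \<Rightarrow> nat \<Rightarrow> real) \<Rightarrow> ('a, nat \<times> nat) circuit \<Rightarrow> (nat \<Rightarrow> nat) \<Rightarrow> real" where
  "spn_fun f \<Phi> x = circuit_poly \<Phi> (\<lambda>(i, j). f i j (x i))"

definition dependency_scope :: "('a, nat \<times> nat) circuit \<Rightarrow> 'a \<Rightarrow> nat set" where
  "dependency_scope \<Phi> u = {i. \<exists>v j. (v, u) \<in> (edges \<Phi>)\<^sup>* \<and> label \<Phi> v = VarLeaf (i, j)}"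

definition decomposable :: "('a, nat \<times> nat) circuit \<Rightarrow> bool" where
  "decomposable \<Phi> \<longleftrightarrow> (\<forall>u\<in>nodes \<Phi>. label \<Phi> u = ProdGate \<longrightarrow>
     disjoint_family_on (dependency_scope \<Phi>) (children \<Phi> u))"

definition complete_spn :: "('a, nat \<times> nat) circuit \<Rightarrow> bool" where
  "complete_spn \<Phi> \<longleftrightarrow> (\<forall>u\<in>nodes \<Phi>. label \<Phi> u = SumGate \<longrightarrow>
     (\<forall>v\<in>children \<Phi> u. \<forall>w\<in>children \<Phi> u. dependency_scope \<Phi> v = dependency_scope \<Phi> w))"

definition is_dc_spn ::
  "nat \<Rightarrow> (nat \<times> nat) set \<Rightarrow> (nat \<Rightarrow> nat \<Rightarrow> nat \<Rightarrow> real) \<Rightarrow> ('a, nat \<times> nat) circuit \<Rightarrow> bool" where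
  "is_dc_spn n J f \<Phi> \<longleftrightarrow> is_spn n J f \<Phi> \<and> decomposable \<Phi> \<and> complete_spn \<Phi>"

text \<open>Points of \<open>{0,1}\<^sup>n\<close> are the elements of \<open>{1..n} \<rightarrow>\<^sub>E {0, 1}\<close>.\<close>

definition EQUAL :: "nat \<Rightarrow> (nat \<Rightarrow> nat) \<Rightarrow> real" where
  "EQUAL n x = (if \<forall>i\<in>{1..n div 2}. x i = x (n div 2 + i) then 1 else 0)"

end

(* EQUAL(x) is the product over i <= n/2 of the indicators of x_i = x_(n/2+i), and each indicator is
   [x_i = 0][x_(n/2+i) = 0] + [x_i = 1][x_(n/2+i) = 1], a complete sum of two decomposable products
   of univariate functions. Distinct indicators depend on disjoint sets of variables, so the outer
   product is decomposable, too. An additional constant factor 1 = 1 * 1 + 0 * 0 of the same shape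
   keeps the depth equal to 4 for n = 0, where the outer product would otherwise be empty. *)

theory Submission
  imports Defs
begin

text \<open>Splitting off the last edge of a path into \<open>u\<close> turns the reflexive
  transitive closure into a recursion over children, so scopes can be computed layer by
  layer.\<close>

lemma dependency_scope_unfold:
  "dependency_scope \<Phi> u =
     {i. \<exists>j. label \<Phi> u = VarLeaf (i, j)} \<union> (\<Union>w\<in>children \<Phi> u. dependency_scope \<Phi> w)"
  unfolding dependency_scope_def children_def by (auto elim: rtranclE intro: rtrancl_into_rtrancl)

text \<open>
  The node \<open>7 * i + c\<close> with \<open>i \<le> m\<close> and \<open>c < 7\<close> belongs to the \<open>i\<close>-th factor: the leaves
  \<open>c = 0, 1\<close> are the indicators of the two values of \<open>x i\<close>, the leaves \<open>c = 2, 3\<close> are those of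
  \<open>x (m + i)\<close>, and \<open>c = 6\<close> is the sum of the products \<open>c = 4, 5\<close>. The constant factor is
  \<open>i = 0\<close>, and the root is \<open>7 * (m + 1)\<close>.
\<close>

definition equal_label :: "nat \<Rightarrow> nat \<Rightarrow> (nat \<times> nat) gate" where
  "equal_label m u =
     (let i = u div 7; c = u mod 7 in
      if u = 7 * (m + 1) \<or> c = 4 \<or> c = 5 then ProdGate
      else if c = 6 then SumGate
      else if i = 0 then ConstLeaf (of_bool (even c))
      else VarLeaf (if c < 2 then i else m + i, c mod 2))"

text \<open>Leaves of even offset feed product \<open>4\<close> and leaves of odd offset feed
  product \<open>5\<close>; for \<open>i > 0\<close> each product thus tests \<open>x i\<close> and
  \<open>x (m + i)\<close> against one common value.\<close>

definition equal_circuit :: "nat \<Rightarrow> (nat, nat \<times> nat) circuit" where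
  "equal_circuit m =
     \<lparr>nodes = {..7 * (m + 1)},
      edges = {(7 * i + a, 7 * i + b) | i a b. i \<le> m \<and>
                 (a, b) \<in> {(0, 4), (2, 4), (1, 5), (3, 5), (4, 6), (5, 6)}} \<union>
              {(7 * i + 6, 7 * (m + 1)) | i. i \<le> m},
      label = equal_label m,
      weight = (\<lambda>v u. 1)\<rparr>"

definition value_indicator :: "nat \<Rightarrow> nat \<Rightarrow> nat \<Rightarrow> real" where
  "value_indicator i j b = of_bool (b = j)"

text \<open>Division by 7 yields block and offset. The root has offset 0 like a leaf, hence it is
  split off first.\<close>

lemma equal_circuit_node_cases:
  assumes "u \<in> nodes (equal_circuit m)"
  obtains (leaf) i c where "i \<le> m" "c < 4" "u = 7 * i + c"
    | (prod0) i where "i \<le> m" "u = 7 * i + 4"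
    | (prod1) i where "i \<le> m" "u = 7 * i + 5"
    | (sum) i where "i \<le> m" "u = 7 * i + 6"
    | (root) "u = 7 * (m + 1)"
proof (cases "u = 7 * (m + 1)")
  case False
  define i c where "i = u div 7" and "c = u mod 7"
  have u: "u = 7 * i + c" and "c < 7"
    by (simp_all add: i_def c_def)
  have "i \<le> m"
    using assms False u by (simp add: equal_circuit_def)
  from \<open>c < 7\<close> consider "c < 4" | "c = 4" | "c = 5" | "c = 6"
    by linarith
  then show thesis
    by cases (use leaf prod0 prod1 sum u \<open>i \<le> m\<close> in blast)+
qed (rule root)

lemma children_equal_circuit:
  assumes "i \<le> m"
  shows "c < 4 \<Longrightarrow> children (equal_circuit m) (7 * i + c) = {}"
    and "children (equal_circuit m) (7 * i + 4) = {7 * i, 7 * i + 2}"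
    and "children (equal_circuit m) (7 * i + 5) = {7 * i + 1, 7 * i + 3}"
    and "children (equal_circuit m) (7 * i + 6) = {7 * i + 4, 7 * i + 5}"
  \<comment> \<open>Offsets below 7 make the form \<open>7 * i + a\<close> unique, so edges of
    different blocks do not interfere.\<close>
  using assms by (auto simp: children_def equal_circuit_def; presburger)+

lemma children_equal_circuit_root:
  "children (equal_circuit m) (7 * (m + 1)) = (\<lambda>i. 7 * i + 6) ` {..m}"
  by (auto simp: children_def equal_circuit_def; presburger)

lemma label_equal_circuit:
  assumes "i \<le> m"
  shows "c < 4 \<Longrightarrow> label (equal_circuit m) (7 * i + c) =
           (if i = 0 then ConstLeaf (of_bool (even c))
            else VarLeaf (if c < 2 then i else m + i, c mod 2))"
    and "label (equal_circuit m) (7 * i + 4) = ProdGate"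
    and "label (equal_circuit m) (7 * i + 5) = ProdGate"
    and "label (equal_circuit m) (7 * i + 6) = SumGate"
  using assms by (auto simp: equal_circuit_def equal_label_def Let_def)

lemma label_equal_circuit_root: "label (equal_circuit m) (7 * (m + 1)) = ProdGate"
  by (simp add: equal_circuit_def equal_label_def)

lemma weight_equal_circuit: "weight (equal_circuit m) v u = 1"
  by (simp add: equal_circuit_def)

text \<open>Every other node has an explicit parent: a leaf the product of its parity, a product the
  sum of its block, a sum the root. All edges start below \<open>7 * (m + 1)\<close>.\<close>

lemma equal_circuit_is_root_iff: "is_root (equal_circuit m) r \<longleftrightarrow> r = 7 * (m + 1)"
proof
  assume r: "is_root (equal_circuit m) r"
  then have no_parent: "r \<notin> children (equal_circuit m) u" for u
    by (simp add: is_root_def children_def)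
  from r have "r \<in> nodes (equal_circuit m)"
    by (simp add: is_root_def)
  then show "r = 7 * (m + 1)"
  proof (cases rule: equal_circuit_node_cases)
    case (leaf i c)
    then have "c = 0 \<or> c = 1 \<or> c = 2 \<or> c = 3"
      by linarith
    then show ?thesis
      using leaf no_parent[of "7 * i + 4"] no_parent[of "7 * i + 5"]
      by (auto simp: children_equal_circuit)
  next
    case (prod0 i)
    then show ?thesis
      using no_parent[of "7 * i + 6"] by (simp add: children_equal_circuit)
  next
    case (prod1 i)
    then show ?thesis
      using no_parent[of "7 * i + 6"] by (simp add: children_equal_circuit)
  next
    case (sum i)
    then show ?thesis
      using no_parent[of "7 * (m + 1)"] unfolding children_equal_circuit_root by auto
  qed
next
  assume "r = 7 * (m + 1)"
  then show "is_root (equal_circuit m) r"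
    unfolding is_root_def equal_circuit_def by (auto; presburger)
qed

lemma root_equal_circuit: "root (equal_circuit m) = 7 * (m + 1)"
  by (simp only: root_def equal_circuit_is_root_iff the_eq_trivial)

lemma arithmetic_circuit_equal_circuit:
  "arithmetic_circuit ({1..2 * m} \<times> {0, 1}) (equal_circuit m)"
proof
  show "finite (nodes (equal_circuit m))"
    by (simp add: equal_circuit_def)
  show "edges (equal_circuit m) \<subseteq> nodes (equal_circuit m) \<times> nodes (equal_circuit m)"
    by (auto simp: equal_circuit_def)
  \<comment> \<open>Node numbers increase along edges, so acyclicity is inherited from the order on
    the naturals.\<close>
  have "edges (equal_circuit m) \<subseteq> less_than"
    by (auto simp: equal_circuit_def)
  then show "acyclic (edges (equal_circuit m))"
    using acyclic_subset wf_acyclic wf_less_than by blast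
  show "\<exists>!r. is_root (equal_circuit m) r"
    by (simp only: equal_circuit_is_root_iff) simp
next
  fix u
  assume "u \<in> nodes (equal_circuit m)"
  then show "children (equal_circuit m) u = {} \<longleftrightarrow>
      (\<exists>y. label (equal_circuit m) u = VarLeaf y) \<or>
      (\<exists>c. label (equal_circuit m) u = ConstLeaf c)"
    by (cases rule: equal_circuit_node_cases)
       (simp_all add: children_equal_circuit label_equal_circuit
         children_equal_circuit_root[simplified] label_equal_circuit_root[simplified])
next
  fix u y
  assume "u \<in> nodes (equal_circuit m)" and "label (equal_circuit m) u = VarLeaf y"
  then show "y \<in> {1..2 * m} \<times> {0, 1}"
    by (cases rule: equal_circuit_node_cases)
       (auto simp: label_equal_circuit label_equal_circuit_root[simplified] split: if_splits)
qed

text \<open>Both products of a block see the same two variables, which is what completeness of the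
  sum above them requires. Block 0 has only constant leaves, so its scopes are empty.\<close>

lemma dependency_scope_equal_circuit:
  fixes i m :: nat
  defines "S \<equiv> (if i = 0 then {} else {i, m + i})"
  assumes "i \<le> m"
  shows "c < 4 \<Longrightarrow> dependency_scope (equal_circuit m) (7 * i + c) =
           (if i = 0 then {} else {if c < 2 then i else m + i})"
    and "dependency_scope (equal_circuit m) (7 * i + 4) = S"
    and "dependency_scope (equal_circuit m) (7 * i + 5) = S"
    and "dependency_scope (equal_circuit m) (7 * i + 6) = S"
proof -
  show leaf: "dependency_scope (equal_circuit m) (7 * i + c) =
      (if i = 0 then {} else {if c < 2 then i else m + i})" if "c < 4" for c
    using assms that
    by (subst dependency_scope_unfold) (auto simp: label_equal_circuit children_equal_circuit)
  show prod0: "dependency_scope (equal_circuit m) (7 * i + 4) = S"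
    using assms leaf[of 0] leaf[of 2]
    by (subst dependency_scope_unfold) (auto simp: label_equal_circuit children_equal_circuit)
  show prod1: "dependency_scope (equal_circuit m) (7 * i + 5) = S"
    using assms leaf[of 1] leaf[of 3]
    by (subst dependency_scope_unfold) (auto simp: label_equal_circuit children_equal_circuit)
  show "dependency_scope (equal_circuit m) (7 * i + 6) = S"
    using assms prod0 prod1
    by (subst dependency_scope_unfold) (auto simp: label_equal_circuit children_equal_circuit)
qed

lemma decomposable_equal_circuit: "decomposable (equal_circuit m)"
  unfolding decomposable_def
proof (intro ballI impI)
  fix u
  assume "u \<in> nodes (equal_circuit m)" and prod_gate: "label (equal_circuit m) u = ProdGate"
  then show "disjoint_family_on (dependency_scope (equal_circuit m)) (children (equal_circuit m) u)"
  proof (cases rule: equal_circuit_node_cases)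
    case (prod0 i)
    then show ?thesis
      using dependency_scope_equal_circuit(1)[of i m 0] dependency_scope_equal_circuit(1)[of i m 2]
      by (auto simp: children_equal_circuit disjoint_family_on_def split: if_splits)
  next
    case (prod1 i)
    then show ?thesis
      using dependency_scope_equal_circuit(1)[of i m 1] dependency_scope_equal_circuit(1)[of i m 3]
      by (auto simp: children_equal_circuit disjoint_family_on_def split: if_splits)
  next
    \<comment> \<open>For \<open>i\<close> and \<open>j\<close> in \<open>{1..m}\<close> one has
      \<open>i \<le> m < m + j\<close>, so \<open>{i, m + i}\<close> and \<open>{j, m + j}\<close>
      can meet only if \<open>i = j\<close>.\<close>
    case root
    then show ?thesis
      unfolding root children_equal_circuit_root
      by (auto simp: disjoint_family_on_def dependency_scope_equal_circuit split: if_splits)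
  qed (use prod_gate in \<open>auto simp: label_equal_circuit split: if_splits\<close>)
qed

lemma complete_equal_circuit: "complete_spn (equal_circuit m)"
  unfolding complete_spn_def
proof (intro ballI impI)
  fix u v w
  assume "u \<in> nodes (equal_circuit m)" and sum_gate: "label (equal_circuit m) u = SumGate"
    and vw: "v \<in> children (equal_circuit m) u" "w \<in> children (equal_circuit m) u"
  then show "dependency_scope (equal_circuit m) v = dependency_scope (equal_circuit m) w"
  proof (cases rule: equal_circuit_node_cases)
    case (sum i)
    then show ?thesis
      using vw by (auto simp: children_equal_circuit dependency_scope_equal_circuit)
  qed (use sum_gate in \<open>auto simp: label_equal_circuit label_equal_circuit_root[simplified]
         split: if_splits\<close>)
qed

lemma monotone_equal_circuit: "monotone_circuit (equal_circuit m)"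
  unfolding monotone_circuit_def
  by (auto simp: weight_equal_circuit label_equal_circuit label_equal_circuit_root[simplified]
      elim!: equal_circuit_node_cases split: if_splits)

lemma is_dc_spn_equal_circuit:
  "is_dc_spn (2 * m) ({1..2 * m} \<times> {0, 1}) value_indicator (equal_circuit m)"
  using arithmetic_circuit_equal_circuit monotone_equal_circuit decomposable_equal_circuit
    complete_equal_circuit
  by (auto simp: is_dc_spn_def is_spn_def value_indicator_def)

lemma prod_of_bool:
  assumes "finite A"
  shows "(\<Prod>i\<in>A. of_bool (P i)) = (of_bool (\<forall>i\<in>A. P i) :: 'a :: comm_semiring_1)"
  using assms by induction auto

lemma spn_fun_equal_circuit:
  assumes x: "x \<in> {1..2 * m} \<rightarrow>\<^sub>E {0, 1}"
  shows "spn_fun value_indicator (equal_circuit m) x = EQUAL (2 * m) x"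
proof -
  interpret arithmetic_circuit "{1..2 * m} \<times> {0, 1}" "equal_circuit m"
    by (rule arithmetic_circuit_equal_circuit)
  define q where "q = node_poly (equal_circuit m) (\<lambda>(i, j). value_indicator i j (x i))"
  note q_unfold = node_poly_unfold[of "\<lambda>(i, j). value_indicator i j (x i)", folded q_def]
  \<comment> \<open>The disjunct \<open>i = 0\<close> makes the constant block a factor 1, which
    drops out of the final conjunction.\<close>
  define P where "P i \<longleftrightarrow> i = 0 \<or> x i = x (m + i)" for i
  have q_sum: "q (7 * i + 6) = of_bool (P i)" if i: "i \<le> m" for i
  proof -
    have leaf: "q (7 * i + c) = (if i = 0 then of_bool (even c)
        else of_bool (x (if c < 2 then i else m + i) = c mod 2))" if "c < 4" for c
      using i that by (subst q_unfold) (simp add: label_equal_circuit value_indicator_def)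
    have "q (7 * i + 4) = q (7 * i) * q (7 * i + 2)"
      using i by (subst q_unfold) (simp add: label_equal_circuit children_equal_circuit)
    moreover have "q (7 * i + 5) = q (7 * i + 1) * q (7 * i + 3)"
      using i by (subst q_unfold) (simp add: label_equal_circuit children_equal_circuit)
    moreover have "q (7 * i + 6) = q (7 * i + 4) + q (7 * i + 5)"
      using i
      by (subst q_unfold)
         (simp add: label_equal_circuit children_equal_circuit weight_equal_circuit)
    \<comment> \<open>For binary values the products test the exclusive events "both 0" and "both
      1", so their sum is exactly the indicator of equality.\<close>
    moreover have "x i \<in> {0, 1}" "x (m + i) \<in> {0, 1}" if "i \<noteq> 0"
      using x i that by (intro PiE_mem[OF x]; simp)+
    ultimately show ?thesis
      using leaf[of 0] leaf[of 1] leaf[of 2] leaf[of 3] by (cases "i = 0") (auto simp: P_def)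
  qed
  have "q (7 * (m + 1)) = (\<Prod>v\<in>(\<lambda>i. 7 * i + 6) ` {..m}. q v)"
    by (subst q_unfold) (simp only: label_equal_circuit_root children_equal_circuit_root gate.case)
  also have "\<dots> = (\<Prod>i\<le>m. of_bool (P i))"
    by (subst prod.reindex) (auto simp: inj_on_def q_sum)
  also have "\<dots> = of_bool (\<forall>i\<in>{..m}. P i)"
    by (rule prod_of_bool) simp
  also have "(\<forall>i\<in>{..m}. P i) \<longleftrightarrow> (\<forall>i\<in>{1..m}. x i = x (m + i))"
    unfolding P_def by (metis atLeastAtMost_iff atMost_iff less_one linorder_not_less)
  finally show ?thesis
    by (simp add: spn_fun_def circuit_poly_def root_equal_circuit[simplified] EQUAL_def q_def)
qed

lemma has_depth_equal_circuit: "has_depth (equal_circuit m) 4"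
proof -
  define layer :: "nat \<Rightarrow> nat" where
    \<comment> \<open>The root must be tested first, since its residue 0 would place it among the
      leaves.\<close>
    "layer u = (if u = 7 * (m + 1) then 4 else if u mod 7 < 4 then 1
       else if u mod 7 = 6 then 3 else 2)" for u
  have "layer ` nodes (equal_circuit m) = {1..4}"
  proof
    show "{1..4} \<subseteq> layer ` nodes (equal_circuit m)"
    proof
      fix d :: nat
      assume "d \<in> {1..4}"
      \<comment> \<open>Block 0 exists for every \<open>m\<close>, so its nodes 0, 4 and 6 witness
        the lower three layers even when \<open>m = 0\<close>.\<close>
      then have "d = layer 0 \<or> d = layer 4 \<or> d = layer 6 \<or> d = layer (7 * (m + 1))"
        by (auto simp: layer_def)
      then show "d \<in> layer ` nodes (equal_circuit m)"
        by (auto simp: equal_circuit_def)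
    qed
  qed (auto simp: layer_def)
  moreover have "layer u = 1 \<longleftrightarrow> children (equal_circuit m) u = {}"
    if "u \<in> nodes (equal_circuit m)" for u
    using that
    by (cases rule: equal_circuit_node_cases)
       (auto simp: layer_def children_equal_circuit children_equal_circuit_root[simplified])
  moreover have "layer u = layer v + 1" if "(v, u) \<in> edges (equal_circuit m)" for u v
    using that by (auto simp: equal_circuit_def layer_def; presburger)
  ultimately show ?thesis
    unfolding has_depth_def by blast
qed

text \<open>There are \<open>m + 1\<close> blocks of seven nodes and one root.\<close>

lemma circuit_size_equal_circuit: "circuit_size (equal_circuit m) = 7 * m + 8"
  by (simp add: circuit_size_def equal_circuit_def)

theorem proposition26:
  "\<exists>s :: nat \<Rightarrow> nat. (\<lambda>n. real (s n)) \<in> O(\<lambda>n. real n) \<and>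
     (\<forall>n. even n \<longrightarrow>
        (\<exists>J f (\<Phi> :: (nat, nat \<times> nat) circuit).
           is_dc_spn n J f \<Phi> \<and>
           (\<forall>x \<in> {1..n} \<rightarrow>\<^sub>E {0, 1}. spn_fun f \<Phi> x = EQUAL n x) \<and>
           circuit_size \<Phi> \<le> s n \<and>
           has_depth \<Phi> 4))"
proof (intro exI[of _ "\<lambda>n. 7 * (n div 2) + 8"] conjI allI impI)
  \<comment> \<open>The restriction to \<open>n \<ge> 1\<close> lets the additive constant 8 be
    absorbed into \<open>8 * n\<close>; the bound fails at \<open>n = 0\<close>.\<close>
  have "real (7 * (n div 2) + 8) \<le> 15 * real n" if "n \<ge> 1" for n
    using that by linarith
  then show "(\<lambda>n. real (7 * (n div 2) + 8)) \<in> O(\<lambda>n. real n)"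
    by (intro bigoI[of _ 15] eventually_sequentiallyI[of 1]) simp
next
  fix n :: nat
  assume "even n"
  then obtain m where "n = 2 * m"
    by (rule evenE)
  then show "\<exists>J f (\<Phi> :: (nat, nat \<times> nat) circuit).
      is_dc_spn n J f \<Phi> \<and>
      (\<forall>x \<in> {1..n} \<rightarrow>\<^sub>E {0, 1}. spn_fun f \<Phi> x = EQUAL n x) \<and>
      circuit_size \<Phi> \<le> 7 * (n div 2) + 8 \<and>
      has_depth \<Phi> 4"
    using is_dc_spn_equal_circuit[of m] spn_fun_equal_circuit[of _ m]
      circuit_size_equal_circuit[of m] has_depth_equal_circuit[of m]
    by (intro exI[of _ "{1..2 * m} \<times> {0, 1}"] exI[of _ value_indicator]
        exI[of _ "equal_circuit m"]) auto
qed

end
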